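(* Let $d=2$ and let $f:\mathbb T\to(0,\infty)$ be a potential. If $\log f$ is $3$-equispacing, then the $3$-point Fibonacci lattice $$\Phi_4=\left\{(0,0),\left(\tfrac13,\tfrac23\right),\left(\tfrac23,\tfrac13\right)\right\}$$ minimizes the tensor product energy $E_F$, i.e. $E_F(Y)\ge E_F(\Phi_4)$ for every $3$-point configuration $Y$ in $\mathbb T^2$.
   Context: $\mathbb T=\mathbb R/\mathbb Z$ is identified with $[0,1)$. A potential $f$ on $\mathbb T$ is viewed as an even $1$-periodic function on $\mathbb R$, continuous on $(0,1)$. With $F(t_1,t_2)=f(t_1)f(t_2)$, the energy of a (multi)set $X=\{\mathbf x^0,\dots,\mathbf x^{N-1}\}\subset\mathbb T^2$ is $E_F(X)=\sum_{k\ne\ell}f(x_1^k-x_1^\ell)f(x_2^k-x_2^\ell)$, the sum over ordered pairs $k\neq\ell$ in $\{0,\dots,N-1\}$. A function $g$ on $\mathbb T$ is $N$-equispacing if for all $x^0,\dots,x^{N-1}\in[0,1)$ one has $\sum_{k\ne\ell}g(x^k-x^\ell)\ge\sum_{k\neq\ell}g\left(\frac kN-\frac\ell N\right)$. *)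

theory Defs
  imports Complex_Main
begin

text \<open>
  Functions on the torus \<open>\<real>/\<int>\<close> are represented by functions on \<open>\<real>\<close>, and its points by their
  representatives in \<open>[0,1)\<close>. Continuity at the integers is not required of a potential.
\<close>

definition potential :: "(real \<Rightarrow> real) \<Rightarrow> bool" where
  "potential f \<longleftrightarrow>
     (\<forall>t. f (t + 1) = f t) \<and> (\<forall>t. f (- t) = f t) \<and> continuous_on {0<..<1} f"

definition equispacing :: "nat \<Rightarrow> (real \<Rightarrow> real) \<Rightarrow> bool" where
  "equispacing N g \<longleftrightarrow>
     (\<forall>x :: nat \<Rightarrow> real. (\<forall>k<N. x k \<in> {0..<1}) \<longrightarrow>
        (\<Sum>k<N. \<Sum>l\<in>{..<N} - {k}. g (x k - x l))
          \<ge> (\<Sum>k<N. \<Sum>l\<in>{..<N} - {k}. g (real k / real N - real l / real N)))"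

text \<open>
  A configuration is a multiset of points of the two-dimensional torus. It is given by a list
  enumerating it with repetition; the energy does not depend on the order of the list.
\<close>

definition configurations :: "nat \<Rightarrow> (real \<times> real) list set" where
  "configurations N = {X. length X = N \<and> set X \<subseteq> {0..<1} \<times> {0..<1}}"

definition tensor_product :: "(real \<Rightarrow> real) \<Rightarrow> real \<Rightarrow> real \<Rightarrow> real" where
  "tensor_product f t1 t2 = f t1 * f t2"

definition energy :: "(real \<Rightarrow> real \<Rightarrow> real) \<Rightarrow> (real \<times> real) list \<Rightarrow> real" where
  "energy F X =
     (\<Sum>k<length X. \<Sum>l\<in>{..<length X} - {k}.
        F (fst (X ! k) - fst (X ! l)) (snd (X ! k) - snd (X ! l)))"

definition Phi4 :: "(real \<times> real) list" where
  "Phi4 = [(0, 0), (1/3, 2/3), (2/3, 1/3)]"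

lemma Phi4_in_configurations: "Phi4 \<in> configurations 3"
  by (simp add: Phi4_def configurations_def)

end

theory Submission
  imports Defs
begin

text \<open>
  All nonzero coordinate differences in \<open>\<Phi>\<^sub>4\<close> are \<open>\<plusminus>1/3\<close> modulo \<open>1\<close>, so every term of its energy
  is \<open>c = f(1/3)\<^sup>2\<close>. The tangent inequality \<open>u \<ge> c (1 + ln u - ln c)\<close>, summed over the terms
  \<open>u\<close> of an arbitrary energy, reduces the claim to the equispacing inequality for \<open>ln f\<close> in each
  of the two coordinates.
\<close>

text \<open>This is \<open>ln x \<le> x - 1\<close> at \<open>x = u / c\<close>, scaled by
  \<open>c\<close>. Equality at \<open>u = c\<close> keeps the bound sharp on the lattice.\<close>

lemma ln_tangent_le:
  fixes u c :: real
  assumes "u > 0" "c > 0"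
  shows "c * (1 + ln u - ln c) \<le> u"
proof -
  have "ln (u / c) \<le> u / c - 1"
    using assms by (intro ln_le_minus_one) simp
  then show ?thesis
    using assms by (simp add: ln_div field_simps)
qed

text \<open>The logarithm turns the product of the two factors into a sum, so each coordinate can be
  treated separately. By \<open>const\<close>, the equispaced side of \<open>eq\<close> is a sum of
  copies of \<open>ln c\<close>.\<close>

lemma energy_tensor_product_ge:
  fixes f :: "real \<Rightarrow> real" and c :: real
  assumes pos: "\<And>t. f t > 0" and c: "c > 0"
    and eq: "equispacing N (\<lambda>t. ln (f t))"
    and const: "\<And>k l. k < N \<Longrightarrow> l < N \<Longrightarrow> k \<noteq> l \<Longrightarrow> f (real k / real N - real l / real N) = c"
    and Y: "Y \<in> configurations N"
  shows "(\<Sum>k<N. \<Sum>l\<in>{..<N} - {k}. c\<^sup>2) \<le> energy (tensor_product f) Y"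
proof -
  let ?S = "\<lambda>h. \<Sum>k<N. \<Sum>l\<in>{..<N} - {k}. (h k l :: real)"
  define a where "a k l = f (fst (Y ! k) - fst (Y ! l))" for k l
  define b where "b k l = f (snd (Y ! k) - snd (Y ! l))" for k l
  have len: "length Y = N" and sub: "set Y \<subseteq> {0..<1} \<times> {0..<1}"
    using Y by (auto simp: configurations_def)
  have mem: "Y ! k \<in> {0..<1} \<times> {0..<1}" if "k < N" for k
    using that len sub nth_mem by blast
  have fst_mem: "fst (Y ! k) \<in> {0..<1}" and snd_mem: "snd (Y ! k) \<in> {0..<1}" if "k < N" for k
    using mem[OF that] by (auto simp: mem_Times_iff)
  have lattice: "?S (\<lambda>k l. ln (f (real k / real N - real l / real N))) = ?S (\<lambda>k l. ln c)"
    by (intro sum.cong refl) (auto simp: const)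
  have a: "?S (\<lambda>k l. ln c) \<le> ?S (\<lambda>k l. ln (a k l))"
    using eq[unfolded equispacing_def, rule_format, of "\<lambda>k. fst (Y ! k)"] fst_mem
    unfolding lattice a_def by blast
  have b: "?S (\<lambda>k l. ln c) \<le> ?S (\<lambda>k l. ln (b k l))"
    using eq[unfolded equispacing_def, rule_format, of "\<lambda>k. snd (Y ! k)"] snd_mem
    unfolding lattice b_def by blast
  \<comment> \<open>The two added terms are nonnegative by \<open>a\<close> and \<open>b\<close>;
    they are shaped to match the tangent bound summed over all pairs.\<close>
  have "?S (\<lambda>k l. c\<^sup>2) \<le> ?S (\<lambda>k l. c\<^sup>2)
      + c\<^sup>2 * (?S (\<lambda>k l. ln (a k l)) - ?S (\<lambda>k l. ln c))
      + c\<^sup>2 * (?S (\<lambda>k l. ln (b k l)) - ?S (\<lambda>k l. ln c))"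
    using a b by simp
  also have "\<dots> = ?S (\<lambda>k l. c\<^sup>2 + c\<^sup>2 * (ln (a k l) - ln c) + c\<^sup>2 * (ln (b k l) - ln c))"
    by (simp only: sum.distrib sum_subtractf flip: sum_distrib_left)
  also have "\<dots> \<le> ?S (\<lambda>k l. a k l * b k l)"
  proof (intro sum_mono)
    fix k l
    have ab: "a k l > 0" "b k l > 0"
      by (simp_all add: a_def b_def pos)
    \<comment> \<open>The tangent point is \<open>c\<^sup>2\<close>, because
      \<open>ln (c\<^sup>2) = 2 * ln c\<close> gives one \<open>ln c\<close> to each
      coordinate.\<close>
    then have "c\<^sup>2 * (1 + ln (a k l * b k l) - ln (c\<^sup>2)) \<le> a k l * b k l"
      using c by (intro ln_tangent_le) auto
    then show "c\<^sup>2 + c\<^sup>2 * (ln (a k l) - ln c) + c\<^sup>2 * (ln (b k l) - ln c) \<le> a k l * b k l"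
      using ab c by (simp add: ln_mult power2_eq_square algebra_simps)
  qed
  also have "\<dots> = energy (tensor_product f) Y"
    by (simp add: energy_def tensor_product_def a_def b_def len)
  finally show ?thesis .
qed

text \<open>Modulo 1, \<open>2/3\<close> is \<open>- (1/3)\<close>, so evenness and periodicity
  identify all four values.\<close>

lemma potential_thirds:
  assumes "potential f"
  shows "f (2/3) = f (1/3)" "f (- (1/3)) = f (1/3)" "f (- (2/3)) = f (1/3)"
proof -
  have per: "f (t + 1) = f t" and even: "f (- t) = f t" for t
    using assms by (auto simp: potential_def)
  show "f (- (1/3)) = f (1/3)"
    by (rule even)
  then show "f (2/3) = f (1/3)"
    using per[of "- (1/3)"] by simp
  then show "f (- (2/3)) = f (1/3)"
    using even[of "2/3"] by simp
qed

theorem corollary2p7: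
  fixes f :: "real \<Rightarrow> real"
  assumes "potential f"
    and "\<And>t. f t > 0"
    and "equispacing 3 (\<lambda>t. ln (f t))"
  shows "\<forall>Y \<in> configurations 3.
           energy (tensor_product f) Y \<ge> energy (tensor_product f) Phi4"
proof
  fix Y assume Y: "Y \<in> configurations 3"
  note thirds = potential_thirds[OF assms(1)]
  have cases3: "k = 0 \<or> k = 1 \<or> k = 2" if "k < 3" for k :: nat
    using that by linarith
  have const: "f (real k / real 3 - real l / real 3) = f (1/3)"
    if "k < 3" "l < 3" "k \<noteq> l" for k l :: nat
    using cases3[OF that(1)] cases3[OF that(2)] that(3) thirds by auto
  have len: "length Phi4 = 3"
    by (simp add: Phi4_def)
  \<comment> \<open>Each coordinate of \<open>Phi4\<close> runs through 0, 1/3, 2/3 once, so both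
    factors of every term equal \<open>f (1/3)\<close>.\<close>
  have "energy (tensor_product f) Phi4 = (\<Sum>k<3::nat. \<Sum>l\<in>{..<3} - {k}. (f (1/3))\<^sup>2)"
    unfolding energy_def len
  proof (intro sum.cong refl)
    fix k l :: nat
    assume "k \<in> {..<3}" "l \<in> {..<3} - {k}"
    then show "tensor_product f (fst (Phi4 ! k) - fst (Phi4 ! l)) (snd (Phi4 ! k) - snd (Phi4 ! l))
        = (f (1/3))\<^sup>2"
      using cases3[of k] cases3[of l] thirds
      by (auto simp: Phi4_def tensor_product_def power2_eq_square)
  qed
  also have "\<dots> \<le> energy (tensor_product f) Y"
    \<comment> \<open>\<open>const\<close> fixes \<open>c = f (1/3)\<close>; the second
      \<open>assms(2)\<close> supplies its positivity.\<close>
    using energy_tensor_product_ge[OF assms(2) assms(2) assms(3) const Y] by simp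
  finally show "energy (tensor_product f) Phi4 \<le> energy (tensor_product f) Y" .
qed

end
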